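(* Let $n\ge1$ and let $\mathrm{Abs}(B_n)$ be the absolute order on the hyperoctahedral group $B_n$. Every closed interval $[u,v]=\{z\in B_n: u\preceq z\preceq v\}$ of $\mathrm{Abs}(B_n)$ (where $u\preceq v$) is shellable.
   Context: Hyperoctahedral group: $B_n$ is the group of permutations $w$ of $\{\pm1,\dots,\pm n\}$ with $w(-i)=-w(i)$ for all $i$. For $a_1,\dots,a_k\in\{\pm1,\dots,\pm n\}$ with pairwise distinct absolute values, the paired $k$-cycle $(\!(a_1,\dots,a_k)\!)$ is the permutation with cycle form $(a_1\,a_2\cdots a_k)(-a_1\,-a_2\cdots -a_k)$, and the balanced $k$-cycle $[a_1,\dots,a_k]$ is the permutation with cycle form $(a_1\,a_2\cdots a_k\,-a_1\,-a_2\cdots -a_k)$. The reflections of $B_n$ are $\mathcal{T}=\{[i]:1\le i\le n\}\cup\{(\!(i,j)\!),(\!(i,-j)\!):1\le i<j\le n\}$. Absolute order: the absolute length $\ell_{\mathcal T}(w)$ is the least $k$ such that $w$ is a product of $k$ elements of $\mathcal T$; $\mathrm{Abs}(B_n)$ is the partial order on $B_n$ given by $u\preceq v$ iff $\ell_{\mathcal T}(u)+\ell_{\mathcal T}(u^{-1}v)=\ell_{\mathcal T}(v)$. The order complex $\Delta(P)$ of a finite poset $P$ is the simplicial complex of all chains of $P$. A pure $d$-dimensional simplicial complex is shellable if its facets admit a total ordering $G_1,\dots,G_m$ such that for all $1<i\le m$ the intersection of $\bar G_1\cup\dots\cup\bar G_{i-1}$ with $\bar G_i$ is pure of dimension $d-1$,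 where $\bar G$ is the set of all subsets of $G$. A poset is shellable if its order complex is. *)

theory Defs
  imports "HOL-Combinatorics.Cycles"
begin

definition signed_points :: "nat \<Rightarrow> int set"
  where "signed_points n = {i. 1 \<le> \<bar>i\<bar> \<and> \<bar>i\<bar> \<le> int n}"

text \<open>
  By the convention of \<^const>\<open>permutes\<close>, a permutation of the points
  \<open>\<plusminus>1, \<dots>, \<plusminus>n\<close> is a function on all integers that is the identity elsewhere.
  The group operation is function composition.
\<close>

definition hyperoctahedral :: "nat \<Rightarrow> (int \<Rightarrow> int) set"
  where "hyperoctahedral n =
    {w. w permutes signed_points n \<and> (\<forall>i\<in>signed_points n. w (- i) = - w i)}"

text \<open>
  The next two definitions are meant for lists of nonzero integers with pairwise distinct
  absolute values.
\<close>

definition paired_cycle :: "int list \<Rightarrow> int \<Rightarrow> int"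
  where "paired_cycle as = cycle_of_list as \<circ> cycle_of_list (map uminus as)"

definition balanced_cycle :: "int list \<Rightarrow> int \<Rightarrow> int"
  where "balanced_cycle as = cycle_of_list (as @ map uminus as)"

definition reflections :: "nat \<Rightarrow> (int \<Rightarrow> int) set"
  where "reflections n =
    {balanced_cycle [i] | i. 1 \<le> i \<and> i \<le> int n} \<union>
    {paired_cycle [i, j] | i j. 1 \<le> i \<and> i < j \<and> j \<le> int n} \<union>
    {paired_cycle [i, - j] | i j. 1 \<le> i \<and> i < j \<and> j \<le> int n}"

definition absolute_length :: "nat \<Rightarrow> (int \<Rightarrow> int) \<Rightarrow> nat"
  where "absolute_length n w =
    (LEAST k. \<exists>ts. length ts = k \<and> set ts \<subseteq> reflections n \<and> w = foldr (\<circ>) ts id)"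

definition absolute_le :: "nat \<Rightarrow> (int \<Rightarrow> int) \<Rightarrow> (int \<Rightarrow> int) \<Rightarrow> bool"
  where "absolute_le n u v \<longleftrightarrow>
    absolute_length n u + absolute_length n (inv u \<circ> v) = absolute_length n v"

definition absolute_interval :: "nat \<Rightarrow> (int \<Rightarrow> int) \<Rightarrow> (int \<Rightarrow> int) \<Rightarrow> (int \<Rightarrow> int) set"
  where "absolute_interval n u v =
    {z \<in> hyperoctahedral n. absolute_le n u z \<and> absolute_le n z v}"

text \<open>
  Finite abstract simplicial complexes are given by their sets of faces. The empty set is a face,
  of dimension \<open>-1\<close>, so dimensions are integers.
\<close>

definition abstract_complex :: "'a set set \<Rightarrow> bool"
  where "abstract_complex K \<longleftrightarrow>
    finite K \<and> K \<noteq> {} \<and> (\<forall>F\<in>K. finite F) \<and> (\<forall>F\<in>K. \<forall>G. G \<subseteq> F \<longrightarrow> G \<in> K)"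

definition facets :: "'a set set \<Rightarrow> 'a set set"
  where "facets K = {F \<in> K. \<forall>G\<in>K. F \<subseteq> G \<longrightarrow> G = F}"

definition face_dim :: "'a set \<Rightarrow> int"
  where "face_dim F = int (card F) - 1"

definition pure_complex :: "int \<Rightarrow> 'a set set \<Rightarrow> bool"
  where "pure_complex d K \<longleftrightarrow> abstract_complex K \<and> (\<forall>F\<in>facets K. face_dim F = d)"

definition shellable_complex :: "'a set set \<Rightarrow> bool"
  where "shellable_complex K \<longleftrightarrow>
    (\<exists>d. pure_complex d K \<and>
      (\<exists>Gs. distinct Gs \<and> set Gs = facets K \<and>
        (\<forall>i. 0 < i \<and> i < length Gs \<longrightarrow>
          pure_complex (d - 1) ((\<Union>j<i. Pow (Gs ! j)) \<inter> Pow (Gs ! i)))))"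

text \<open>A poset is given by its underlying set and its (non-strict) order relation.\<close>

definition order_complex :: "'a set \<Rightarrow> ('a \<Rightarrow> 'a \<Rightarrow> bool) \<Rightarrow> 'a set set"
  where "order_complex P le = {C. C \<subseteq> P \<and> Complete_Partial_Order.chain le C}"

definition shellable_poset :: "'a set \<Rightarrow> ('a \<Rightarrow> 'a \<Rightarrow> bool) \<Rightarrow> bool"
  where "shellable_poset P le \<longleftrightarrow> shellable_complex (order_complex P le)"

end

theory Submission
  imports Defs "HOL-Library.List_Lexorder"
begin

text \<open>
  Label a reflection by the largest absolute value that it moves. If \<open>s\<close>, \<open>t\<close> are distinct
  reflections and the label of \<open>t\<close> is at most that of \<open>s\<close>, then \<open>s t = s' t'\<close> where the labels of
  \<open>s'\<close>, \<open>t'\<close> increase strictly and the label of \<open>s'\<close> is less than that of \<open>s\<close>. On the other hand, a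
  word with strictly increasing labels is determined by its product \<open>w\<close>: the last letter swaps the
  largest point \<open>m\<close> moved by \<open>w\<close> with \<open>w\<^sup>-\<^sup>1 m\<close>. Rewriting at descents therefore shows that each
  \<open>w\<close> has exactly one rising word, and that this word is reduced and lexicographically first. Maximal
  chains of \<open>[u, v]\<close> correspond to reduced words of \<open>u\<^sup>-\<^sup>1 v\<close>, and their lexicographic order is a
  shelling: a maximal chain that is not first has a descent, and straightening it exchanges one
  element and yields an earlier chain.
\<close>

section \<open>Facets and shellings\<close>

text \<open>A facet of the intersection lies in some \<open>Gs ! j \<inter> Gs ! i\<close>, hence in
  one of the sets \<open>Gs ! h \<inter> Gs ! i\<close> of size \<open>d\<close>. That set is itself
  a face, so maximality makes the two equal.\<close>

lemma pure_complexI_codim_one: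
  fixes Gs :: "'a set list"
  assumes "0 < i" and "finite (Gs ! i)"
    and ex: "\<And>j. j < i \<Longrightarrow>
      \<exists>h<i. Gs ! j \<inter> Gs ! i \<subseteq> Gs ! h \<inter> Gs ! i \<and> int (card (Gs ! h \<inter> Gs ! i)) = d"
  shows "pure_complex (d - 1) ((\<Union>j<i. Pow (Gs ! j)) \<inter> Pow (Gs ! i))"
proof -
  let ?K = "(\<Union>j<i. Pow (Gs ! j)) \<inter> Pow (Gs ! i)"
  have "?K \<subseteq> Pow (Gs ! i)" by blast
  then have "finite ?K" using assms(2) by (meson finite_Pow_iff finite_subset)
  moreover have "{} \<in> ?K" using assms(1) by auto
  moreover have "\<forall>F\<in>?K. finite F" using assms(2) by (auto intro: finite_subset)
  moreover have "\<forall>F\<in>?K. \<forall>G. G \<subseteq> F \<longrightarrow> G \<in> ?K" by blast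
  ultimately have "abstract_complex ?K" unfolding abstract_complex_def by blast
  moreover have "face_dim F = d - 1" if F: "F \<in> facets ?K" for F
  proof -
    from F obtain j where j: "j < i" "F \<subseteq> Gs ! j" "F \<subseteq> Gs ! i" unfolding facets_def by auto
    from ex[OF j(1)] obtain h where h: "h < i" "Gs ! j \<inter> Gs ! i \<subseteq> Gs ! h \<inter> Gs ! i"
      "int (card (Gs ! h \<inter> Gs ! i)) = d" by blast
    have "Gs ! h \<inter> Gs ! i \<in> ?K" using h(1) by auto
    moreover have "F \<subseteq> Gs ! h \<inter> Gs ! i" using j h by blast
    ultimately have "Gs ! h \<inter> Gs ! i = F" using F unfolding facets_def by blast
    then show ?thesis using h(3) by (auto simp: face_dim_def)
  qed
  ultimately show ?thesis unfolding pure_complex_def by blast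
qed

section \<open>Words in labelled involutions\<close>

abbreviation word_prod :: "('a \<Rightarrow> 'a) list \<Rightarrow> 'a \<Rightarrow> 'a"
  where "word_prod ts \<equiv> foldr (\<circ>) ts id"

lemma word_prod_simps: "word_prod [] = id" "word_prod (t # ts) = t \<circ> word_prod ts"
  by simp_all

lemma word_prod_append: "word_prod (xs @ ys) = word_prod xs \<circ> word_prod ys"
  by (induction xs) (auto simp: comp_assoc)

text \<open>This rule would turn the product of a concatenation into a \<open>foldr\<close> with a
  start value other than \<open>id\<close>, where \<open>word_prod_append\<close> no longer
  matches.\<close>

declare foldr_append [simp del]

text \<open>These properties are all that the shelling argument takes from the reflections and their
  labels. In \<open>straighten\<close>, the inequality \<open>lab s' < lab s\<close> makes rewriting
  at a descent lower the label word; \<open>rising_unique\<close> identifies the end result of the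
  rewriting.\<close>

locale labelled_involutions =
  fixes T :: "('a \<Rightarrow> 'a) set" and lab :: "('a \<Rightarrow> 'a) \<Rightarrow> nat"
  assumes finite_T: "finite T"
    and involution: "t \<in> T \<Longrightarrow> t \<circ> t = id"
    and straighten: "s \<in> T \<Longrightarrow> t \<in> T \<Longrightarrow> lab t \<le> lab s \<Longrightarrow> s \<circ> t \<noteq> id \<Longrightarrow>
      \<exists>s'\<in>T. \<exists>t'\<in>T. s' \<circ> t' = s \<circ> t \<and> lab s' < lab t' \<and> lab s' < lab s"
    and rising_unique: "set xs \<subseteq> T \<Longrightarrow> set ys \<subseteq> T \<Longrightarrow>
      sorted_wrt (<) (map lab xs) \<Longrightarrow> sorted_wrt (<) (map lab ys) \<Longrightarrow>
      word_prod xs = word_prod ys \<Longrightarrow> xs = ys"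
begin

abbreviation rising :: "('a \<Rightarrow> 'a) list \<Rightarrow> bool"
  where "rising ts \<equiv> sorted_wrt (<) (map lab ts)"

definition generated :: "('a \<Rightarrow> 'a) set"
  where "generated = {word_prod ts | ts. set ts \<subseteq> T}"

definition len :: "('a \<Rightarrow> 'a) \<Rightarrow> nat"
  where "len w = (LEAST k. \<exists>ts. length ts = k \<and> set ts \<subseteq> T \<and> w = word_prod ts)"

definition le :: "('a \<Rightarrow> 'a) \<Rightarrow> ('a \<Rightarrow> 'a) \<Rightarrow> bool"
  where "le u v \<longleftrightarrow> len u + len (inv u \<circ> v) = len v"

definition interval :: "('a \<Rightarrow> 'a) \<Rightarrow> ('a \<Rightarrow> 'a) \<Rightarrow> ('a \<Rightarrow> 'a) set"
  where "interval u v = {z \<in> generated. le u z \<and> le z v}"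

definition reduced :: "('a \<Rightarrow> 'a) list \<Rightarrow> bool"
  where "reduced ts \<longleftrightarrow> set ts \<subseteq> T \<and> length ts = len (word_prod ts)"

text \<open>The vertices of the path that starts at \<open>u\<close> and multiplies by the letters
  of \<open>ts\<close> on the right. The indices run from 0 to \<open>length ts\<close>, so both end
  points belong to it.\<close>

definition chain_of :: "('a \<Rightarrow> 'a) \<Rightarrow> ('a \<Rightarrow> 'a) list \<Rightarrow> ('a \<Rightarrow> 'a) set"
  where "chain_of u ts = (\<lambda>i. u \<circ> word_prod (take i ts)) ` {..length ts}"

lemma word_prod_rev: "set ts \<subseteq> T \<Longrightarrow> word_prod (rev ts) \<circ> word_prod ts = id"
proof (induction ts)
  case (Cons t ts)
  have "word_prod (rev (t # ts)) \<circ> word_prod (t # ts)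
      = word_prod (rev ts) \<circ> (t \<circ> t) \<circ> word_prod ts"
    by (simp add: word_prod_append comp_assoc)
  also have "\<dots> = id"
    by (metis Cons.IH Cons.prems comp_id involution list.set_intros(1) set_subset_Cons subset_iff)
  finally show ?case .
qed simp

lemma word_prod_rev': "set ts \<subseteq> T \<Longrightarrow> word_prod ts \<circ> word_prod (rev ts) = id"
  using word_prod_rev[of "rev ts"] by simp

section \<open>The group generated by the involutions\<close>

lemma generatedE:
  assumes "w \<in> generated"
  obtains ts where "set ts \<subseteq> T" "w = word_prod ts"
  using assms unfolding generated_def by blast

lemma word_prod_generated [intro]: "set ts \<subseteq> T \<Longrightarrow> word_prod ts \<in> generated"
  unfolding generated_def by blast

lemma bij_generated: "w \<in> generated \<Longrightarrow> bij w"
  by (erule generatedE) (simp add: o_bij[OF word_prod_rev word_prod_rev'])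

lemma inv_word_prod: "set ts \<subseteq> T \<Longrightarrow> inv (word_prod ts) = word_prod (rev ts)"
  by (intro inv_unique_comp word_prod_rev word_prod_rev')

lemma generated_inv: "w \<in> generated \<Longrightarrow> inv w \<in> generated"
  using inv_word_prod word_prod_generated[of "rev ts" for ts] by (fastforce elim: generatedE)

lemma generated_comp: "u \<in> generated \<Longrightarrow> v \<in> generated \<Longrightarrow> u \<circ> v \<in> generated"
proof (elim generatedE)
  fix xs ys assume "set xs \<subseteq> T" "u = word_prod xs" "set ys \<subseteq> T" "v = word_prod ys"
  then show "u \<circ> v \<in> generated" using word_prod_generated[of "xs @ ys"] by (simp add: word_prod_append)
qed

lemma inv_comp_generated:
  assumes "u \<in> generated"
  shows "inv u \<circ> u = id" "u \<circ> inv u = id" "inv u \<circ> (u \<circ> x) = x" "u \<circ> (inv u \<circ> x) = x"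
proof -
  have "inj u" "surj u" using bij_generated[OF assms] by (auto simp: bij_def)
  then show l: "inv u \<circ> u = id" and r: "u \<circ> inv u = id" by (simp_all flip: surj_iff)
  show "inv u \<circ> (u \<circ> x) = x" unfolding comp_assoc[symmetric] l by simp
  show "u \<circ> (inv u \<circ> x) = x" unfolding comp_assoc[symmetric] r by simp
qed

lemma left_cancel: "u \<in> generated \<Longrightarrow> u \<circ> x = u \<circ> y \<longleftrightarrow> x = y"
  by (metis inv_comp_generated(3))

section \<open>Length and reduced words\<close>

lemma len_le: "set ts \<subseteq> T \<Longrightarrow> len (word_prod ts) \<le> length ts"
  unfolding len_def by (intro Least_le exI[of _ ts]) simp

lemma reduced_word:
  assumes "w \<in> generated"
  obtains ts where "reduced ts" "word_prod ts = w"
proof -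
  obtain ts where "set ts \<subseteq> T" "w = word_prod ts" using assms by (rule generatedE)
  then have "\<exists>k ts. length ts = k \<and> set ts \<subseteq> T \<and> w = word_prod ts"
    by (intro exI[of _ "length ts"] exI[of _ ts]) simp
  from LeastI_ex[OF this] have "\<exists>ts. length ts = len w \<and> set ts \<subseteq> T \<and> w = word_prod ts"
    unfolding len_def .
  then obtain rs where rs: "length rs = len w" "set rs \<subseteq> T" "w = word_prod rs"
    by (elim exE conjE)
  show ?thesis
  proof (rule that)
    show "reduced rs" unfolding reduced_def using rs by simp
  qed (rule rs(3)[symmetric])
qed

lemma len_comp: "u \<in> generated \<Longrightarrow> v \<in> generated \<Longrightarrow> len (u \<circ> v) \<le> len u + len v"
proof -
  assume "u \<in> generated" "v \<in> generated"
  then obtain xs ys where "reduced xs" "word_prod xs = u" "reduced ys" "word_prod ys = v"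
    using reduced_word by metis
  then show ?thesis
    using len_le[of "xs @ ys"] by (auto simp: reduced_def word_prod_append)
qed

lemma len_id: "len id = 0"
  using len_le[of "[]"] by simp

lemma len_eq_0: "w \<in> generated \<Longrightarrow> len w = 0 \<Longrightarrow> w = id"
  by (erule reduced_word) (auto simp: reduced_def)

text \<open>By subadditivity of \<open>len\<close>, a shorter word for one part would shorten the
  whole.\<close>

lemma reduced_append:
  assumes "reduced (xs @ ys)"
  shows "reduced xs" "reduced ys"
proof -
  have s: "set xs \<subseteq> T" "set ys \<subseteq> T" and l: "length xs + length ys = len (word_prod xs \<circ> word_prod ys)"
    using assms by (auto simp: reduced_def word_prod_append)
  have "len (word_prod xs \<circ> word_prod ys) \<le> len (word_prod xs) + len (word_prod ys)"
    using s by (intro len_comp word_prod_generated)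
  then show "reduced xs" "reduced ys"
    using s l len_le[of xs] len_le[of ys] by (auto simp: reduced_def)
qed

lemma reduced_take: "reduced ts \<Longrightarrow> reduced (take i ts)"
  by (metis append_take_drop_id reduced_append(1))

lemma reduced_drop: "reduced ts \<Longrightarrow> reduced (drop i ts)"
  by (metis append_take_drop_id reduced_append(2))

section \<open>The order defined by the length\<close>

lemma le_refl: "u \<in> generated \<Longrightarrow> le u u"
  by (simp add: le_def inv_comp_generated len_id)

text \<open>Equal lengths leave length 0 for the quotient, which is then \<open>id\<close>. This
  identifies the top element of a chain in \<open>chain_extends\<close>.\<close>

lemma le_len_eq:
  assumes "u \<in> generated" "v \<in> generated" "le u v \<or> le v u" "len u = len v"
  shows "u = v"
proof -
  have "x = y" if "x \<in> generated" "y \<in> generated" "le x y" "len x = len y" for x y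
  proof -
    have "inv x \<circ> y = id"
      using that by (intro len_eq_0 generated_comp generated_inv) (auto simp: le_def)
    then show ?thesis using inv_comp_generated(4)[of x y] that by simp
  qed
  then show ?thesis using assms by metis
qed

lemma le_imp_len_le: "le u v \<Longrightarrow> len u \<le> len v"
  by (auto simp: le_def)

section \<open>Rising words\<close>

lemma not_rising_descent:
  assumes "\<not> rising ts"
  obtains xs s t ys where "ts = xs @ s # t # ys" "lab t \<le> lab s"
proof -
  from assms obtain i where i: "Suc i < length ts" "\<not> lab (ts ! i) < lab (ts ! Suc i)"
    by (auto simp: sorted_wrt_iff_nth_Suc_transp)
  then have "ts = take i ts @ ts ! i # ts ! Suc i # drop (Suc (Suc i)) ts"
    by (metis Cons_nth_drop_Suc Suc_lessD append_take_drop_id)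
  then show ?thesis using that i(2) by (metis not_less)
qed

text \<open>The common prefix \<open>xs\<close> cancels in the comparison and
  \<open>lab s' < lab s\<close> decides it, whatever follows.\<close>

lemma straighten_word:
  assumes "set (xs @ s # t # ys) \<subseteq> T" "lab t \<le> lab s" "s \<circ> t \<noteq> id"
  obtains s' t' where "set (xs @ s' # t' # ys) \<subseteq> T"
    "word_prod (xs @ s' # t' # ys) = word_prod (xs @ s # t # ys)"
    "map lab (xs @ s' # t' # ys) < map lab (xs @ s # t # ys)"
proof -
  from assms straighten[of s t] obtain s' t'
    where st: "s' \<in> T" "t' \<in> T" "s' \<circ> t' = s \<circ> t" "lab s' < lab s" by auto
  have "s' \<circ> (t' \<circ> g) = s \<circ> (t \<circ> g)" for g :: "'a \<Rightarrow> 'a" using st(3) by (metis comp_assoc)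
  moreover have "map lab (xs @ s' # t' # ys) < map lab (xs @ s # t # ys)"
    using st(4) by (auto simp: list_less_def intro!: lexord_append_leftI)
  ultimately show ?thesis using that[of s' t'] st assms by (simp add: word_prod_append)
qed

text \<open>At a descent, either the two letters cancel and the word gets shorter, or they are
  straightened at equal length. Both steps descend in a well-founded order, so the rewriting ends in
  a rising word. The last conclusion keeps the comparison with the initial word for
  \<open>rising_less\<close>.\<close>

lemma rising_word:
  assumes "set ts \<subseteq> T"
  obtains rs where "set rs \<subseteq> T" "rising rs" "word_prod rs = word_prod ts"
    "rs = ts \<or> length rs < length ts \<or> length rs = length ts \<and> map lab rs < map lab ts"
proof -
  \<comment> \<open>Lengths are compared first: the plain lexicographic order on lists of unbounded
    length is not well founded.\<close>
  let ?R = "inv_image (lenlex less_than) (map lab)"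
  have wf: "wf ?R" by (simp add: wf_lenlex wf_inv_image)
  have less: "(a, b) \<in> ?R \<longleftrightarrow>
      length a < length b \<or> length a = length b \<and> map lab a < map lab b" for a b
  proof -
    have "less_than = {(u, v). u < v}" by auto
    then show ?thesis
      by (auto simp: lenlex_conv list_less_def lexord_lex)
  qed
  have "\<exists>rs. set rs \<subseteq> T \<and> rising rs \<and> word_prod rs = word_prod ts \<and> (rs = ts \<or> (rs, ts) \<in> ?R)"
    using assms
  proof (induction ts rule: wf_induct_rule[OF wf])
    case (1 ts)
    show ?case
    proof (cases "rising ts")
      case True
      then show ?thesis using 1 by blast
    next
      case False
      then obtain xs s t ys where d: "ts = xs @ s # t # ys" "lab t \<le> lab s"
        by (rule not_rising_descent)
      have "\<exists>ts'. set ts' \<subseteq> T \<and> word_prod ts' = word_prod ts \<and> (ts', ts) \<in> ?R"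
      proof (cases "s \<circ> t = id")
        case True
        then have "s \<circ> (t \<circ> g) = g" for g :: "'a \<Rightarrow> 'a" by (metis comp_assoc id_comp)
        then have "word_prod (xs @ ys) = word_prod ts" by (simp add: d word_prod_append)
        then show ?thesis using 1(2) d unfolding less by (intro exI[of _ "xs @ ys"]) auto
      next
        case False
        with 1(2) d obtain s' t' where "set (xs @ s' # t' # ys) \<subseteq> T"
          "word_prod (xs @ s' # t' # ys) = word_prod (xs @ s # t # ys)"
          "map lab (xs @ s' # t' # ys) < map lab (xs @ s # t # ys)"
          using straighten_word by metis
        then show ?thesis using d unfolding less by (intro exI[of _ "xs @ s' # t' # ys"]) simp
      qed
      then obtain ts' where ts': "set ts' \<subseteq> T" "word_prod ts' = word_prod ts" "(ts', ts) \<in> ?R"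
        by blast
      obtain rs where rs: "set rs \<subseteq> T" "rising rs" "word_prod rs = word_prod ts'"
        "rs = ts' \<or> (rs, ts') \<in> ?R"
        using 1(1)[OF ts'(3,1)] by blast
      have "(rs, ts) \<in> ?R" using rs(4) ts'(3) unfolding less by auto
      then show ?thesis using rs(1-3) ts'(2) by metis
    qed
  qed
  then show ?thesis using that unfolding less by blast
qed

text \<open>By uniqueness \<open>rs\<close> is the rising word that rewriting produces from
  \<open>ts\<close>; with equal lengths and distinct words only the lexicographic alternative is
  left.\<close>

lemma rising_less:
  assumes "set ts \<subseteq> T" "set rs \<subseteq> T" "rising rs" "word_prod rs = word_prod ts"
    "length rs = length ts" "rs \<noteq> ts"
  shows "map lab rs < map lab ts"
  using rising_word[OF assms(1)] rising_unique assms by (metis less_irrefl)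

section \<open>The lexicographic shelling\<close>

text \<open>The whole word raises the length of \<open>u\<close> by \<open>length ts\<close>, and
  each letter can raise it by at most one. So every prefix raises it by exactly its own
  length.\<close>

lemma chain_of_rank:
  assumes u: "u \<in> generated" and ts: "reduced ts" and "le u (u \<circ> word_prod ts)" and "i \<le> length ts"
  shows "u \<circ> word_prod (take i ts) \<in> generated"
    "len (u \<circ> word_prod (take i ts)) = len u + i"
    "le (u \<circ> word_prod (take i ts)) (u \<circ> word_prod ts)"
proof -
  let ?x = "u \<circ> word_prod (take i ts)"
  have T: "set (take i ts) \<subseteq> T" "set (drop i ts) \<subseteq> T" "set ts \<subseteq> T"
    using ts unfolding reduced_def by (auto dest: in_set_takeD in_set_dropD)
  have l: "len (word_prod (take i ts)) = i" "len (word_prod (drop i ts)) = length ts - i"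
      "len (word_prod ts) = length ts"
    using reduced_take[OF ts, of i] reduced_drop[OF ts, of i] ts assms(4)
    by (auto simp: reduced_def)
  show x: "?x \<in> generated" using T u by (intro generated_comp) auto
  have eq: "u \<circ> word_prod ts = ?x \<circ> word_prod (drop i ts)"
    by (metis append_take_drop_id comp_assoc word_prod_append)
  have d: "word_prod (drop i ts) \<in> generated" using T by auto
  have "len (u \<circ> word_prod ts) = len u + length ts"
    using assms(3) u l(3) by (simp add: le_def inv_comp_generated)
  moreover have "len (u \<circ> word_prod ts) \<le> len ?x + (length ts - i)"
    unfolding eq using len_comp[OF x d] l by simp
  moreover have "len ?x \<le> len u + i" using len_comp[of u "word_prod (take i ts)"] T u l by auto
  ultimately show lx: "len ?x = len u + i" using assms(4) by linarith
  have "inv ?x \<circ> (u \<circ> word_prod ts) = word_prod (drop i ts)"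
    unfolding eq using inv_comp_generated(3)[OF x] .
  then show "le ?x (u \<circ> word_prod ts)"
    unfolding le_def using lx l \<open>len (u \<circ> word_prod ts) = len u + length ts\<close> assms(4) by simp
qed

text \<open>The first \<open>j\<close> letters are a reduced word themselves, so
  \<open>chain_of_rank\<close> applies with the upper end point moved down to index
  \<open>j\<close>.\<close>

lemma le_chain_of:
  assumes u: "u \<in> generated" and ts: "reduced ts" and uv: "le u (u \<circ> word_prod ts)"
    and "i \<le> j" "j \<le> length ts"
  shows "le (u \<circ> word_prod (take i ts)) (u \<circ> word_prod (take j ts))"
proof -
  have "le u (u \<circ> word_prod (take j ts))"
    using chain_of_rank(2)[OF u ts uv assms(5)] reduced_take[OF ts, of j] u assms(5)
    by (simp add: le_def inv_comp_generated reduced_def)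
  then show ?thesis
    using chain_of_rank(3)[OF u reduced_take[OF ts, of j], of i] assms by (simp add: min_def)
qed

text \<open>The length of an element determines its index, so two such chains from \<open>u\<close>
  to the same end can only meet at equal indices.\<close>

lemma chain_of_eq_iff:
  assumes u: "u \<in> generated" and ts: "reduced ts" and ts': "reduced ts'"
    and eq: "word_prod ts = word_prod ts'" and uv: "le u (u \<circ> word_prod ts)" and i: "i \<le> length ts"
  shows "u \<circ> word_prod (take i ts) \<in> chain_of u ts' \<longleftrightarrow>
    word_prod (take i ts) = word_prod (take i ts')"
proof
  have l: "length ts = length ts'" using ts ts' eq by (simp add: reduced_def)
  {
    assume "u \<circ> word_prod (take i ts) \<in> chain_of u ts'"
    then obtain j where j: "j \<le> length ts'" "u \<circ> word_prod (take i ts) = u \<circ> word_prod (take j ts')"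
      by (auto simp: chain_of_def)
    then have "i = j"
      using chain_of_rank(2)[OF u ts uv i] chain_of_rank(2)[OF u ts' _ j(1)] uv eq by simp
    then show "word_prod (take i ts) = word_prod (take i ts')"
      using j(2) left_cancel[OF u] by metis
  next
    assume "word_prod (take i ts) = word_prod (take i ts')"
    then show "u \<circ> word_prod (take i ts) \<in> chain_of u ts'"
      using i l by (auto simp: chain_of_def)
  }
qed

lemma card_chain_of:
  assumes "u \<in> generated" "reduced ts" "le u (u \<circ> word_prod ts)"
  shows "card (chain_of u ts) = Suc (length ts)"
proof -
  \<comment> \<open>The index is recovered as the length of the element minus
    \<open>len u\<close>.\<close>
  have "inj_on (\<lambda>i. u \<circ> word_prod (take i ts)) {..length ts}"
    by (rule inj_on_inverseI[of _ "\<lambda>x. len x - len u"]) (simp add: chain_of_rank(2)[OF assms])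
  then show ?thesis unfolding chain_of_def by (simp add: card_image)
qed

text \<open>A letter is the quotient of two consecutive prefix products.\<close>

lemma take_Suc_eq:
  assumes "set ts \<subseteq> T" "set ts' \<subseteq> T" "i < length ts" "i < length ts'"
    "word_prod (take i ts) = word_prod (take i ts')"
    "word_prod (take (Suc i) ts) = word_prod (take (Suc i) ts')"
  shows "ts ! i = ts' ! i"
proof -
  have "set (take i ts) \<subseteq> T" using assms(1) by (auto dest: in_set_takeD)
  then show ?thesis
    using assms left_cancel[OF word_prod_generated, of "take i ts" "ts ! i" "ts' ! i"]
    by (simp add: take_Suc_conv_app_nth word_prod_append)
qed

lemma words_eq_of_prefix_products:
  assumes "set ts \<subseteq> T" "set ts' \<subseteq> T" "length ts = length ts'"
    "\<And>i. i \<le> length ts \<Longrightarrow> word_prod (take i ts) = word_prod (take i ts')"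
  shows "ts = ts'"
  using assms by (intro nth_equalityI take_Suc_eq) auto

text \<open>Prefix products before the changed pair involve the same letters; those after it are the
  common total product with the same tail cancelled. Only the product between the two letters
  changes.\<close>

lemma chain_of_adjacent:
  assumes u: "u \<in> generated" and ts: "reduced ts" and ts': "reduced ts'"
    and eq: "word_prod ts = word_prod ts'" and uv: "le u (u \<circ> word_prod ts)" and ne: "ts' \<noteq> ts"
    and split: "ts = xs @ s # t # ys" "ts' = xs @ s' # t' # ys"
  shows "chain_of u ts' \<inter> chain_of u ts = chain_of u ts - {u \<circ> word_prod (xs @ [s])}"
proof -
  \<comment> \<open>The prefix of this length ends in \<open>s\<close> (in \<open>ts\<close>) or in
    \<open>s'\<close> (in \<open>ts'\<close>).\<close>
  define r where "r = Suc (length xs)"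
  have T: "set ts \<subseteq> T" "set ts' \<subseteq> T" and len: "length ts = length ts'"
    using ts ts' eq by (auto simp: reduced_def)
  have prefix: "word_prod (take m ts) = word_prod (take m ts')" if "m \<noteq> r" for m
  proof (cases "m < r")
    case True
    then show ?thesis unfolding split r_def by simp
  next
    case False
    then have drop: "drop m ts = drop m ts'"
      using that unfolding split r_def by (auto simp: drop_Cons')
    have "word_prod (take m a) = word_prod a \<circ> word_prod (rev (drop m a))" if "set a \<subseteq> T" for a
    proof -
      have "set (drop m a) \<subseteq> T" using that by (auto dest: in_set_dropD)
      then show ?thesis
        using word_prod_rev'[of "drop m a"] word_prod_append[of "take m a" "drop m a"]
        by (simp add: comp_assoc)
    qed
    then show ?thesis using T eq drop by simp
  qed
  \<comment> \<open>If this product agreed as well, all prefix products would agree and the words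
    would be equal.\<close>
  have "word_prod (take r ts) \<noteq> word_prod (take r ts')"
    using words_eq_of_prefix_products[OF T len] prefix ne by metis
  then have mem: "u \<circ> word_prod (take m ts) \<in> chain_of u ts' \<longleftrightarrow> m \<noteq> r" if "m \<le> length ts" for m
    using chain_of_eq_iff[OF u ts ts' eq uv that] prefix by metis
  have x: "xs @ [s] = take r ts" and r: "r \<le> length ts" unfolding split r_def by simp_all
  show ?thesis
    unfolding x
  proof (intro set_eqI iffI)
    fix y assume "y \<in> chain_of u ts' \<inter> chain_of u ts"
    then show "y \<in> chain_of u ts - {u \<circ> word_prod (take r ts)}" using mem[OF r] by auto
  next
    fix y assume y: "y \<in> chain_of u ts - {u \<circ> word_prod (take r ts)}"
    then obtain m where "m \<le> length ts" "y = u \<circ> word_prod (take m ts)" "m \<noteq> r"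
      by (auto simp: chain_of_def)
    then show "y \<in> chain_of u ts' \<inter> chain_of u ts" using mem y by auto
  qed
qed

section \<open>Maximal chains of an interval\<close>

lemma finite_interval:
  assumes "u \<in> generated"
  shows "finite (interval u v)"
proof -
  let ?W = "{ts. set ts \<subseteq> T \<and> length ts \<le> len v}"
  have "interval u v \<subseteq> word_prod ` ?W"
  proof
    fix z assume "z \<in> interval u v"
    then have z: "z \<in> generated" "len z \<le> len v" by (auto simp: interval_def le_imp_len_le)
    then obtain ts where "reduced ts" "word_prod ts = z" using reduced_word by blast
    then show "z \<in> word_prod ` ?W" using z by (auto simp: reduced_def)
  qed
  then show ?thesis using finite_lists_length_le[OF finite_T] by (rule finite_surj[rotated])
qed

text \<open>Induction on the chain: remove its longest element \<open>z\<close>, fit the rest into a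
  path from \<open>u\<close> to \<open>z\<close>, and append a reduced word that leads from
  \<open>z\<close> to \<open>v\<close>.\<close>

lemma chain_extends:
  assumes "u \<in> generated" "v \<in> generated" "le u v"
    and "finite C" "C \<subseteq> interval u v" "Complete_Partial_Order.chain le C"
  shows "\<exists>ts. reduced ts \<and> u \<circ> word_prod ts = v \<and> C \<subseteq> chain_of u ts"
  using assms(4,2,3,5,6)
proof (induction C arbitrary: v rule: finite_psubset_induct)
  case (psubset C)
  show ?case
  proof (cases "C = {}")
    case True
    have "inv u \<circ> v \<in> generated" by (intro generated_comp generated_inv assms(1) psubset.prems(1))
    then obtain ts where "reduced ts" "word_prod ts = inv u \<circ> v" by (rule reduced_word)
    then have "u \<circ> word_prod ts = v" using assms(1) by (simp add: inv_comp_generated)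
    then show ?thesis using True \<open>reduced ts\<close> by blast
  next
    case False
    then have "Max (len ` C) \<in> len ` C" using psubset.hyps by (intro Max_in) auto
    then obtain z where "z \<in> C" "Max (len ` C) = len z" by blast
    then have z: "z \<in> C" "\<And>x. x \<in> C \<Longrightarrow> len x \<le> len z"
      using psubset.hyps Max_ge[of "len ` C"] by auto
    then have zG: "z \<in> generated" "le u z" "le z v" using psubset.prems by (auto simp: interval_def)
    \<comment> \<open>Members of a chain are comparable, and maximality of \<open>len z\<close>
      fixes the direction, up to equality.\<close>
    have below: "le x z" if x: "x \<in> C" for x
    proof -
      have xG: "x \<in> generated" using x psubset.prems by (auto simp: interval_def)
      have "le x z \<or> le z x"
        using psubset.prems(4) x z(1) by (auto simp: Complete_Partial_Order.chain_def)
      then show ?thesis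
      proof
        assume zx: "le z x"
        then have "len x = len z" using z(2)[OF x] le_imp_len_le[OF zx] by simp
        then have "x = z" using le_len_eq[OF xG zG(1)] zx by blast
        then show ?thesis using le_refl[OF zG(1)] by simp
      qed
    qed
    have "\<exists>ts. reduced ts \<and> u \<circ> word_prod ts = z \<and> C - {z} \<subseteq> chain_of u ts"
    proof (rule psubset.IH)
      show "C - {z} \<subset> C" using z(1) by blast
      show "C - {z} \<subseteq> interval u z" using psubset.prems below by (auto simp: interval_def)
      show "Complete_Partial_Order.chain le (C - {z})"
        using psubset.prems(4) by (auto simp: Complete_Partial_Order.chain_def)
    qed (use zG in auto)
    then obtain xs where xs: "reduced xs" "u \<circ> word_prod xs = z" "C - {z} \<subseteq> chain_of u xs" by blast
    have "inv z \<circ> v \<in> generated" by (intro generated_comp generated_inv zG(1) psubset.prems(1))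
    then obtain ys where ys: "reduced ys" "word_prod ys = inv z \<circ> v" by (rule reduced_word)
    have v: "u \<circ> word_prod (xs @ ys) = v"
      by (simp only: word_prod_append comp_assoc[symmetric] xs(2) ys(2)
          inv_comp_generated(2)[OF zG(1)] id_comp)
    have "len (word_prod xs) = length xs" "inv u \<circ> z = word_prod xs"
      using xs assms(1) by (auto simp: reduced_def inv_comp_generated)
    moreover have "inv u \<circ> v = word_prod (xs @ ys)"
      unfolding v[symmetric] using inv_comp_generated(3)[OF assms(1)] .
    \<comment> \<open>The length differences along \<open>u\<close>, \<open>z\<close>,
      \<open>v\<close> add up, so the concatenation is reduced.\<close>
    ultimately have "len (word_prod (xs @ ys)) = length (xs @ ys)"
      using zG psubset.prems(2) ys by (simp add: le_def reduced_def)
    then have "reduced (xs @ ys)" using xs ys by (simp add: reduced_def)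
    moreover have "chain_of u xs \<subseteq> chain_of u (xs @ ys)"
    proof
      fix y assume "y \<in> chain_of u xs"
      then obtain i where "i \<le> length xs" "y = u \<circ> word_prod (take i xs)"
        by (auto simp: chain_of_def)
      then have "i \<le> length (xs @ ys)" "y = u \<circ> word_prod (take i (xs @ ys))" by auto
      then show "y \<in> chain_of u (xs @ ys)" unfolding chain_of_def by blast
    qed
    moreover have "z \<in> chain_of u xs"
      unfolding chain_of_def using xs(2) by (intro image_eqI[of _ _ "length xs"]) simp_all
    ultimately show ?thesis using v xs(3) by blast
  qed
qed

lemma chain_of_in_order_complex:
  assumes "u \<in> generated" "reduced ts" "le u (u \<circ> word_prod ts)"
  shows "chain_of u ts \<in> order_complex (interval u (u \<circ> word_prod ts)) le"
proof -
  have "le u (u \<circ> word_prod (take i ts))" if "i \<le> length ts" for i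
    using le_chain_of[OF assms, of 0 i] that by simp
  then have "chain_of u ts \<subseteq> interval u (u \<circ> word_prod ts)"
    unfolding chain_of_def interval_def using chain_of_rank[OF assms] by auto
  moreover have "Complete_Partial_Order.chain le (chain_of u ts)"
    unfolding Complete_Partial_Order.chain_def
  proof (intro ballI)
    fix x y assume "x \<in> chain_of u ts" "y \<in> chain_of u ts"
    then obtain i j where "i \<le> length ts" "x = u \<circ> word_prod (take i ts)"
      and "j \<le> length ts" "y = u \<circ> word_prod (take j ts)" unfolding chain_of_def by blast
    then show "le x y \<or> le y x"
      using le_chain_of[OF assms, of i j] le_chain_of[OF assms, of j i] by (cases "i \<le> j") simp_all
  qed
  ultimately show ?thesis by (simp add: order_complex_def)
qed

text \<open>Every chain lies in some \<open>chain_of u ts\<close>, and all of these have the same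
  size, so none of them is properly contained in another face.\<close>

lemma facets_order_complex:
  assumes "u \<in> generated" "v \<in> generated" "le u v"
  shows "facets (order_complex (interval u v) le) =
    chain_of u ` {ts. reduced ts \<and> word_prod ts = inv u \<circ> v}" (is "facets ?K = chain_of u ` ?W")
proof
  have v: "u \<circ> word_prod ts = v" if "ts \<in> ?W" for ts
    using that assms(1) by (simp add: inv_comp_generated)
  have inK: "chain_of u ts \<in> ?K" if "ts \<in> ?W" for ts
    using chain_of_in_order_complex[OF assms(1), of ts, unfolded v[OF that]] that assms(3) by blast
  have ext: "\<exists>ts\<in>?W. C \<subseteq> chain_of u ts" if "C \<in> ?K" for C
  proof -
    have "C \<subseteq> interval u v" "Complete_Partial_Order.chain le C"
      using that by (auto simp: order_complex_def)
    moreover have "finite C" using calculation(1) finite_interval[OF assms(1)] finite_subset by blast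
    ultimately obtain ts where ts: "reduced ts" "u \<circ> word_prod ts = v" "C \<subseteq> chain_of u ts"
      using chain_extends[OF assms] by blast
    have "word_prod ts = inv u \<circ> v"
      by (simp only: ts(2)[symmetric] inv_comp_generated(3)[OF assms(1)])
    then show ?thesis using ts by blast
  qed
  show "facets ?K \<subseteq> chain_of u ` ?W"
  proof
    fix F assume F: "F \<in> facets ?K"
    then obtain ts where "ts \<in> ?W" "F \<subseteq> chain_of u ts" using ext unfolding facets_def by blast
    moreover from this have "chain_of u ts = F" using F inK unfolding facets_def by blast
    ultimately show "F \<in> chain_of u ` ?W" by blast
  qed
  have card: "card (chain_of u ts) = Suc (len (inv u \<circ> v))" if "ts \<in> ?W" for ts
    using card_chain_of[OF assms(1), of ts, unfolded v[OF that]] that assms(3)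
    by (simp add: reduced_def)
  show "chain_of u ` ?W \<subseteq> facets ?K"
  proof
    fix F assume "F \<in> chain_of u ` ?W"
    then obtain ts where ts: "ts \<in> ?W" "F = chain_of u ts" by blast
    have "G = F" if G: "G \<in> ?K" "F \<subseteq> G" for G
    proof -
      obtain ts' where ts': "ts' \<in> ?W" "G \<subseteq> chain_of u ts'" using ext[OF G(1)] by blast
      have "finite (chain_of u ts')" by (simp add: chain_of_def)
      moreover have "F \<subseteq> chain_of u ts'" using G(2) ts'(2) by blast
      moreover have "card F = card (chain_of u ts')"
        unfolding ts(2) card[OF ts(1)] card[OF ts'(1)] ..
      ultimately have "F = chain_of u ts'" by (rule card_subset_eq)
      then show ?thesis using ts' G by blast
    qed
    then show "F \<in> facets ?K" using inK ts unfolding facets_def by blast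
  qed
qed

text \<open>
  Between the point where two words part and the next point where their products agree, the
  lexicographically larger one cannot be rising.
\<close>

lemma descent_off_common_prefix:
  assumes ts: "set ts \<subseteq> T" and ts': "set ts' \<subseteq> T" and len: "length ts = length ts'"
    and eq: "word_prod ts = word_prod ts'" and ne: "ts \<noteq> ts'" and le: "map lab ts \<le> map lab ts'"
  obtains r where "0 < r" "r < length ts'" "lab (ts' ! r) \<le> lab (ts' ! (r - 1))"
    "word_prod (take r ts) \<noteq> word_prod (take r ts')"
proof -
  let ?S = "\<lambda>i. word_prod (take i ts) = word_prod (take i ts')"
  have ex: "\<exists>i. i < length ts \<and> ts ! i \<noteq> ts' ! i" using ne len nth_equalityI by blast
  \<comment> \<open>The first position at which the letters differ.\<close>
  define p where "p = (LEAST i. i < length ts \<and> ts ! i \<noteq> ts' ! i)"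
  have p: "p < length ts" "ts ! p \<noteq> ts' ! p" using LeastI_ex[OF ex] unfolding p_def by auto
  have "ts ! i = ts' ! i" if "i < p" for i
    using not_less_Least[of i] that p(1) unfolding p_def by (metis (mono_tags, lifting) less_trans)
  then have pre: "take p ts = take p ts'"
    using p(1) len by (intro nth_equalityI) auto
  \<comment> \<open>The first index beyond \<open>p\<close> at which the prefix products agree
    again; it exists because the full products agree.\<close>
  define q where "q = (LEAST i. p < i \<and> ?S i)"
  have "p < length ts \<and> ?S (length ts)" using p(1) eq len by simp
  then have q: "p < q" "?S q" "q \<le> length ts"
    using LeastI[of "\<lambda>i. p < i \<and> ?S i"] Least_le[of "\<lambda>i. p < i \<and> ?S i"]
    unfolding q_def by blast+
  have q_least: "\<not> ?S i" if "p < i" "i < q" for i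
    using not_less_Least[of i "\<lambda>i. p < i \<and> ?S i"] that unfolding q_def by blast
  let ?B = "drop p (take q ts)" and ?B' = "drop p (take q ts')"
  have split: "xs = take p xs @ drop p (take q xs) @ drop q xs" for xs :: "('a \<Rightarrow> 'a) list"
    using q(1) by (metis append.assoc append_take_drop_id less_imp_le_nat min.absorb1 take_take)
  \<comment> \<open>The segments \<open>?B\<close> and \<open>?B'\<close> have equal products and
    different first letters. Were \<open>?B'\<close> rising, its label word would be strictly
    smaller than that of \<open>?B\<close>, which would put \<open>ts'\<close> before
    \<open>ts\<close>.\<close>
  have "\<not> rising ?B'"
  proof
    assume r: "rising ?B'"
    have T: "set ?B \<subseteq> T" "set ?B' \<subseteq> T" "set (take p ts) \<subseteq> T"
      using ts ts' by (auto dest!: in_set_takeD in_set_dropD)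
    have tq: "take q xs = take p xs @ drop p (take q xs)" for xs :: "('a \<Rightarrow> 'a) list"
      using q(1) by (metis append_take_drop_id less_imp_le_nat min.absorb1 take_take)
    have "word_prod (take p ts) \<circ> word_prod ?B = word_prod (take p ts) \<circ> word_prod ?B'"
      using q(2) tq[of ts] tq[of ts'] pre by (metis word_prod_append)
    then have "word_prod ?B = word_prod ?B'"
      unfolding left_cancel[OF word_prod_generated[OF T(3)]] .
    moreover have "?B' \<noteq> ?B"
    proof
      assume "?B' = ?B"
      then have "?B' ! 0 = ?B ! 0" by simp
      then show False using p q len by simp
    qed
    moreover have "length ?B' = length ?B" using len by simp
    ultimately have "map lab ?B' < map lab ?B" using rising_less[OF T(1,2) r] by simp
    \<comment> \<open>Segments of equal length decide the comparison before the tails are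
      reached.\<close>
    then have "map lab (?B' @ drop q ts') < map lab (?B @ drop q ts)"
      using len unfolding list_less_def map_append by (intro lexord_sufI) auto
    then have "map lab (take p ts @ ?B' @ drop q ts') < map lab (take p ts @ ?B @ drop q ts)"
      unfolding list_less_def map_append by (intro lexord_append_leftI) auto
    moreover have "ts' = take p ts @ ?B' @ drop q ts'" unfolding pre by (rule split)
    ultimately have "map lab ts' < map lab ts" by (simp only: split[of ts, symmetric])
    then show False using le by simp
  qed
  then obtain i where i: "Suc i < length ?B'" "lab (?B' ! Suc i) \<le> lab (?B' ! i)"
    by (auto simp: sorted_wrt_iff_nth_Suc_transp not_less)
  have nth: "?B' ! j = ts' ! (p + j)" if "j < length ?B'" for j
    using that p(1) q(1) len by (subst nth_drop) simp_all
  show ?thesis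
  proof (rule that)
    \<comment> \<open>The descent of \<open>?B'\<close> at \<open>i\<close>, \<open>Suc i\<close>
      gives \<open>r = p + Suc i\<close>, which lies strictly between \<open>p\<close> and
      \<open>q\<close>.\<close>
    show "\<not> ?S (p + Suc i)" using i(1) by (intro q_least) simp_all
    show "p + Suc i < length ts'" using i(1) by simp
    show "lab (ts' ! (p + Suc i)) \<le> lab (ts' ! (p + Suc i - 1))"
      using i(2) nth[OF i(1)] nth[of i] i(1) by simp
  qed simp
qed

text \<open>Facets are listed by increasing label words of their reduced words. Given an earlier
  facet, the later one is straightened at a descent where the two chains are apart; this yields an
  earlier facet that misses just that one vertex and so contains the common part of the given
  two.\<close>

theorem shellable_interval:
  assumes u: "u \<in> generated" and v: "v \<in> generated" and uv: "le u v"
  shows "shellable_poset (interval u v) le"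
proof -
  let ?K = "order_complex (interval u v) le"
  define W where "W = {ts. reduced ts \<and> word_prod ts = inv u \<circ> v}"
  define d where "d = len (inv u \<circ> v)"
  have W: "set ts \<subseteq> T" "reduced ts" "length ts = d" "word_prod ts = inv u \<circ> v"
    "u \<circ> word_prod ts = v" "le u (u \<circ> word_prod ts)" if "ts \<in> W" for ts
    using that u uv by (auto simp: W_def d_def reduced_def inv_comp_generated)
  have WI: "ts \<in> W" if "set ts \<subseteq> T" "length ts = d" "word_prod ts = inv u \<circ> v" for ts
    using that by (simp add: W_def d_def reduced_def)
  have finW: "finite W"
    using W(1,3) by (intro finite_subset[OF _ finite_lists_length_eq[OF finite_T, of d]]) blast
  have card: "card (chain_of u ts) = Suc d" if "ts \<in> W" for ts
    using card_chain_of[OF u] W[OF that] by simp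
  have facets: "facets ?K = chain_of u ` W"
    unfolding W_def using facets_order_complex[OF u v uv] .
  have fin: "finite (interval u v)" using finite_interval[OF u] .
  have "abstract_complex ?K"
    unfolding abstract_complex_def
  proof (intro conjI ballI allI impI)
    show "finite ?K" using fin by (auto simp: order_complex_def intro: finite_subset[of _ "Pow (interval u v)"])
    show "?K \<noteq> {}" by (auto simp: order_complex_def Complete_Partial_Order.chain_def)
    show "finite F" if "F \<in> ?K" for F using that fin finite_subset by (auto simp: order_complex_def)
    show "G \<in> ?K" if "F \<in> ?K" "G \<subseteq> F" for F G
      using that by (auto simp: order_complex_def Complete_Partial_Order.chain_def)
  qed
  then have pure: "pure_complex (int d) ?K"
    unfolding pure_complex_def facets by (auto simp: face_dim_def card)
  have inj: "inj_on (chain_of u) W"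
  proof (rule inj_onI)
    fix ts ts' assume a: "ts \<in> W" "ts' \<in> W" and eq: "chain_of u ts = chain_of u ts'"
    note h = W[OF a(1)] W[OF a(2)]
    show "ts = ts'"
    proof (rule words_eq_of_prefix_products)
      fix i assume i: "i \<le> length ts"
      then have "u \<circ> word_prod (take i ts) \<in> chain_of u ts'"
        unfolding eq[symmetric] by (simp add: chain_of_def)
      then show "word_prod (take i ts) = word_prod (take i ts')"
        using chain_of_eq_iff[OF u] h i by simp
    qed (use h in simp_all)
  qed
  obtain L where L: "set L = W" "distinct L" using finite_distinct_list[OF finW] by blast
  \<comment> \<open>Different words may have the same label word. Their relative order is arbitrary,
    because straightening lowers the label word strictly.\<close>
  define Ws where "Ws = sort_key (map lab) L"
  have Ws: "set Ws = W" "distinct Ws" "sorted (map (map lab) Ws)"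
    using L by (auto simp: Ws_def)
  let ?Gs = "map (chain_of u) Ws"
  have "pure_complex (int d - 1) ((\<Union>j<i. Pow (?Gs ! j)) \<inter> Pow (?Gs ! i))"
    if i: "0 < i" "i < length ?Gs" for i
  proof (rule pure_complexI_codim_one[OF i(1)])
    show "finite (?Gs ! i)" using i by (simp add: chain_of_def)
    fix j assume j: "j < i"
    define ts ts' where "ts = Ws ! j" and "ts' = Ws ! i"
    have tsW: "ts \<in> W" "ts' \<in> W" using i j Ws(1) by (auto simp: ts_def ts'_def)
    note h = W[OF tsW(1)] and h' = W[OF tsW(2)]
    have "ts \<noteq> ts'" using i j Ws(2) by (auto simp: ts_def ts'_def nth_eq_iff_index_eq)
    moreover have "map lab ts \<le> map lab ts'"
      using sorted_nth_mono[OF Ws(3), of j i] i j by (simp add: ts_def ts'_def)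
    ultimately obtain r where r: "0 < r" "r < length ts'" "lab (ts' ! r) \<le> lab (ts' ! (r - 1))"
      "word_prod (take r ts) \<noteq> word_prod (take r ts')"
      using descent_off_common_prefix[OF h(1) h'(1)] h h' by auto
    define xs s t ys where "xs = take (r - 1) ts'" and "s = ts' ! (r - 1)" and "t = ts' ! r"
      and "ys = drop (Suc r) ts'"
    have ts'_eq: "ts' = xs @ s # t # ys"
      using r(1,2) unfolding xs_def s_def t_def ys_def
      by (metis Cons_nth_drop_Suc Suc_diff_1 append_take_drop_id less_imp_diff_less)
    have lxs: "length xs = r - 1" using r unfolding xs_def by simp
    \<comment> \<open>A cancelling pair cannot occur in a reduced word.\<close>
    have "s \<circ> t \<noteq> id"
    proof
      assume "s \<circ> t = id"
      moreover have "reduced (xs @ [s, t] @ ys)" using h'(2) ts'_eq by simp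
      then have "reduced [s, t]" by (rule reduced_append(1)[OF reduced_append(2)])
      ultimately show False by (simp add: reduced_def len_id)
    qed
    moreover have "set (xs @ s # t # ys) \<subseteq> T" using h'(1) ts'_eq by simp
    moreover have "lab t \<le> lab s" using r(3) by (simp add: s_def t_def)
    ultimately obtain s' t' where new: "set (xs @ s' # t' # ys) \<subseteq> T"
      "word_prod (xs @ s' # t' # ys) = word_prod (xs @ s # t # ys)"
      "map lab (xs @ s' # t' # ys) < map lab (xs @ s # t # ys)"
      using straighten_word by blast
    define ts'' where "ts'' = xs @ s' # t' # ys"
    have "ts'' \<in> W"
    proof (rule WI)
      show "set ts'' \<subseteq> T" using new(1) by (simp add: ts''_def)
      show "length ts'' = d" unfolding ts''_def h'(3)[symmetric] by (simp add: ts'_eq)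
      show "word_prod ts'' = inv u \<circ> v"
        unfolding ts''_def h'(4)[symmetric] new(2) ts'_eq[symmetric] ..
    qed
    note h'' = W[OF this]
    obtain k where k: "k < length Ws" "Ws ! k = ts''" using \<open>ts'' \<in> W\<close> Ws(1) by (metis in_set_conv_nth)
    have "k < i"
    proof (rule ccontr)
      assume "\<not> k < i"
      then have "map lab ts' \<le> map lab ts''"
        using sorted_nth_mono[OF Ws(3), of i k] k i by (simp add: ts'_def)
      then show False using new(3) unfolding ts''_def ts'_eq by (metis leD)
    qed
    \<comment> \<open>The vertex between the letters \<open>s\<close> and \<open>t\<close>: the only
      one of this facet that \<open>ts''\<close> gives up, and one that the chain of
      \<open>ts\<close> does not contain.\<close>
    let ?x = "u \<circ> word_prod (xs @ [s])"
    have x: "xs @ [s] = take r ts'"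
      using r(1,2) unfolding xs_def s_def by (metis Suc_diff_1 less_imp_diff_less take_Suc_conv_app_nth)
    have xC: "?x \<in> chain_of u ts'" unfolding x using r(2) by (auto simp: chain_of_def)
    have x_notin: "?x \<notin> chain_of u ts"
      unfolding x using chain_of_eq_iff[OF u h'(2) h(2)] h h' r by auto
    have "ts'' \<noteq> ts'" using new(3) unfolding ts''_def ts'_eq by (metis less_irrefl)
    then have int: "chain_of u ts'' \<inter> chain_of u ts' = chain_of u ts' - {?x}"
      using chain_of_adjacent[OF u h'(2) h''(2) _ h'(6) _ ts'_eq ts''_def] h'(4) h''(4) by simp
    have "card (chain_of u ts'' \<inter> chain_of u ts') = d"
      unfolding int using card[OF tsW(2)] xC by simp
    moreover have "chain_of u ts \<inter> chain_of u ts' \<subseteq> chain_of u ts'' \<inter> chain_of u ts'"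
      unfolding int using x_notin by blast
    ultimately show "\<exists>h<i. ?Gs ! j \<inter> ?Gs ! i \<subseteq> ?Gs ! h \<inter> ?Gs ! i \<and>
        int (card (?Gs ! h \<inter> ?Gs ! i)) = int d"
      using \<open>k < i\<close> k i j by (intro exI[of _ k]) (simp add: ts_def ts'_def)
  qed
  moreover have "distinct ?Gs" using Ws inj by (simp add: distinct_map)
  moreover have "set ?Gs = facets ?K" using Ws facets by simp
  ultimately show ?thesis
    unfolding shellable_poset_def shellable_complex_def using pure by blast
qed

end

section \<open>Reflections of the hyperoctahedral group\<close>

text \<open>One formula for all reflections: \<open>((x, y))\<close> if the absolute values differ,
  and \<open>[x]\<close> if \<open>y = - x\<close>.\<close>

definition signed_swap :: "int \<Rightarrow> int \<Rightarrow> int \<Rightarrow> int"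
  where "signed_swap x y p = (if p = x then y else if p = y then x
    else if p = - x then - y else if p = - y then - x else p)"

text \<open>The label of a reflection: \<open>i\<close> for \<open>[i]\<close>, and \<open>j\<close>
  for \<open>((i, j))\<close> and \<open>((i, -j))\<close> with \<open>i < j\<close>.\<close>

definition max_moved :: "(int \<Rightarrow> int) \<Rightarrow> nat"
  where "max_moved t = (LEAST m. \<forall>p. int m < \<bar>p\<bar> \<longrightarrow> t p = p)"

lemma signed_swap_commute: "signed_swap x y = signed_swap y x"
  by (rule ext) (auto simp: signed_swap_def)

lemma signed_swap_uminus: "x \<noteq> 0 \<Longrightarrow> y \<noteq> 0 \<Longrightarrow> signed_swap (- x) (- y) = signed_swap x y"
  by (rule ext) (auto simp: signed_swap_def)

lemma signed_swap_neg: "x \<noteq> 0 \<Longrightarrow> y \<noteq> 0 \<Longrightarrow> signed_swap x y (- p) = - signed_swap x y p"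
  by (auto simp: signed_swap_def)

lemma signed_swap_involution:
  "x \<noteq> 0 \<Longrightarrow> y \<noteq> 0 \<Longrightarrow> signed_swap x y \<circ> signed_swap x y = id"
  by (rule ext) (auto simp: signed_swap_def)

text \<open>Conjugation only renames the two points. Most exchange identities in
  \<open>reflections_straighten\<close> are instances of this.\<close>

lemma signed_swap_conjugate:
  assumes "inj t" "\<And>p. t (- p) = - t p"
  shows "t \<circ> signed_swap x y = signed_swap (t x) (t y) \<circ> t"
proof
  fix p
  have eq: "t p = t q \<longleftrightarrow> p = q" "t p = - t q \<longleftrightarrow> p = - q" for p q
    using assms by (metis injD)+
  show "(t \<circ> signed_swap x y) p = (signed_swap (t x) (t y) \<circ> t) p"
    by (simp add: signed_swap_def eq assms(2))
qed

lemma max_moved_signed_swap: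
  assumes "x \<noteq> 0" "y \<noteq> 0" "x \<noteq> y"
  shows "int (max_moved (signed_swap x y)) = max \<bar>x\<bar> \<bar>y\<bar>"
proof -
  have "max_moved (signed_swap x y) = nat (max \<bar>x\<bar> \<bar>y\<bar>)"
    unfolding max_moved_def
  proof (rule Least_equality)
    show "\<forall>p. int (nat (max \<bar>x\<bar> \<bar>y\<bar>)) < \<bar>p\<bar> \<longrightarrow> signed_swap x y p = p"
      by (auto simp: signed_swap_def)
    fix m assume m: "\<forall>p. int m < \<bar>p\<bar> \<longrightarrow> signed_swap x y p = p"
    have "signed_swap x y x \<noteq> x" "signed_swap x y y \<noteq> y" using assms by (auto simp: signed_swap_def)
    then have "\<not> int m < \<bar>x\<bar>" "\<not> int m < \<bar>y\<bar>" using m by blast+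
    then show "nat (max \<bar>x\<bar> \<bar>y\<bar>) \<le> m" by auto
  qed
  then show ?thesis by (simp add: le_max_iff_disj)
qed

section \<open>Reflections as signed swaps\<close>

lemma balanced_cycle_eq: "balanced_cycle [i] = signed_swap i (- i)"
  by (rule ext) (auto simp: balanced_cycle_def signed_swap_def transpose_def)

lemma paired_cycle_eq:
  assumes "i \<noteq> 0" "j \<noteq> 0" "\<bar>i\<bar> \<noteq> \<bar>j\<bar>"
  shows "paired_cycle [i, j] = signed_swap i j"
  using assms by (intro ext) (auto simp: paired_cycle_def signed_swap_def transpose_def)

text \<open>Exchanging the points and negating both reduces to \<open>0 < i\<close> and
  \<open>i \<le> \<bar>j\<bar>\<close>, where the three families of reflections can be read
  off.\<close>

lemma signed_swap_reflection:
  assumes "x \<noteq> 0" "y \<noteq> 0" "x \<noteq> y" "\<bar>x\<bar> \<le> int n" "\<bar>y\<bar> \<le> int n"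
  shows "signed_swap x y \<in> reflections n"
proof -
  have pos: "signed_swap i j \<in> reflections n"
    if "0 < i" "j \<noteq> 0" "i \<noteq> j" "i \<le> \<bar>j\<bar>" "\<bar>j\<bar> \<le> int n" for i j
  proof -
    consider "j = - i" | "i < j" | "i < - j" using \<open>0 < i\<close> \<open>i \<noteq> j\<close> \<open>i \<le> \<bar>j\<bar>\<close> by linarith
    then show ?thesis
    proof cases
      case 1
      then have "signed_swap i j = balanced_cycle [i]" by (simp add: balanced_cycle_eq)
      then show ?thesis using that 1 unfolding reflections_def by auto
    next
      case 2
      then have "signed_swap i j = paired_cycle [i, j]" using that by (simp add: paired_cycle_eq)
      then show ?thesis using that 2 unfolding reflections_def by auto
    next
      case 3
      then have "signed_swap i j = paired_cycle [i, - (- j)]" using that by (simp add: paired_cycle_eq)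
      moreover have "1 \<le> i \<and> i < - j \<and> - j \<le> int n" using that 3 by auto
      ultimately show ?thesis unfolding reflections_def by blast
    qed
  qed
  have "signed_swap i j \<in> reflections n"
    if "i \<noteq> 0" "j \<noteq> 0" "i \<noteq> j" "\<bar>i\<bar> \<le> \<bar>j\<bar>" "\<bar>j\<bar> \<le> int n" for i j
    using pos[of i j] pos[of "- i" "- j"] that by (cases "0 < i") (auto simp: signed_swap_uminus)
  then show ?thesis using assms signed_swap_commute by (metis linear)
qed

text \<open>A normal form with the label \<open>a\<close> as first point; the second point
  \<open>x\<close> is the image of \<open>a\<close>.\<close>

lemma reflectionE:
  assumes "t \<in> reflections n"
  obtains a x where "t = signed_swap a x" "0 < a" "a \<le> int n" "x \<noteq> 0" "\<bar>x\<bar> \<le> a" "x \<noteq> a"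
    "int (max_moved t) = a"
proof -
  have "\<exists>a x. t = signed_swap a x \<and> 0 < a \<and> a \<le> int n \<and> x \<noteq> 0 \<and> \<bar>x\<bar> \<le> a \<and> x \<noteq> a"
  proof -
    from assms consider i where "t = balanced_cycle [i]" "1 \<le> i" "i \<le> int n"
      | i j where "t = paired_cycle [i, j]" "1 \<le> i" "i < j" "j \<le> int n"
      | i j where "t = paired_cycle [i, - j]" "1 \<le> i" "i < j" "j \<le> int n"
      unfolding reflections_def by blast
    then show ?thesis
    proof cases
      case (1 i)
      then show ?thesis by (intro exI[of _ i] exI[of _ "- i"]) (auto simp: balanced_cycle_eq)
    next
      case (2 i j)
      then show ?thesis
        by (intro exI[of _ j] exI[of _ i]) (auto simp: paired_cycle_eq signed_swap_commute)
    next
      case (3 i j)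
      then have "t = signed_swap j (- i)"
        using signed_swap_uminus[of j "- i"] by (simp add: paired_cycle_eq signed_swap_commute)
      then show ?thesis using 3 by (intro exI[of _ j] exI[of _ "- i"]) auto
    qed
  qed
  then show ?thesis using that max_moved_signed_swap by fastforce
qed

lemma reflection_involution: "t \<in> reflections n \<Longrightarrow> t \<circ> t = id"
  by (erule reflectionE) (simp add: signed_swap_involution)

lemma reflection_fixes: "t \<in> reflections n \<Longrightarrow> int (max_moved t) < \<bar>p\<bar> \<Longrightarrow> t p = p"
  by (erule reflectionE) (auto simp: signed_swap_def)

lemma reflection_moves: "t \<in> reflections n \<Longrightarrow> t (int (max_moved t)) \<noteq> int (max_moved t)"
  by (erule reflectionE) (auto simp: signed_swap_def)

lemma reflection_eq_signed_swap:
  assumes "t \<in> reflections n"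
  shows "t = signed_swap (int (max_moved t)) (t (int (max_moved t)))"
proof -
  obtain a x where "t = signed_swap a x" "int (max_moved t) = a" using assms by (rule reflectionE)
  moreover from this have "t a = x" by (simp add: signed_swap_def)
  ultimately show ?thesis by simp
qed

lemma inj_reflection: "t \<in> reflections n \<Longrightarrow> inj t"
  by (rule inj_on_inverseI[of _ t]) (metis comp_apply id_apply reflection_involution)

lemma inj_word: "set ts \<subseteq> reflections n \<Longrightarrow> inj (word_prod ts)"
proof (induction ts)
  case (Cons t ts)
  then have "inj (word_prod ts)" by (intro Cons.IH) simp
  moreover have "inj t" using Cons.prems inj_reflection by auto
  ultimately have "inj (t \<circ> word_prod ts)" by (intro inj_compose)
  then show ?case unfolding word_prod_simps .
qed simp

lemma finite_reflections: "finite (reflections n)"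
proof -
  have "reflections n \<subseteq> (\<lambda>(a, x). signed_swap a x) ` ({- int n..int n} \<times> {- int n..int n})"
  proof
    fix t assume "t \<in> reflections n"
    then obtain a x where "t = signed_swap a x" "0 < a" "a \<le> int n" "\<bar>x\<bar> \<le> a" by (rule reflectionE)
    then show "t \<in> (\<lambda>(a, x). signed_swap a x) ` ({- int n..int n} \<times> {- int n..int n})"
      by (intro image_eqI[of _ _ "(a, x)"]) auto
  qed
  then show ?thesis by (rule finite_subset) simp
qed

text \<open>The product is rewritten so that the point \<open>a\<close>, the label of
  \<open>s\<close>, is moved by the right factor only.\<close>

lemma reflections_straighten:
  assumes s: "s \<in> reflections n" and t: "t \<in> reflections n"
    and le: "max_moved t \<le> max_moved s" and ne: "s \<circ> t \<noteq> id"
  shows "\<exists>s'\<in>reflections n. \<exists>t'\<in>reflections n.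
    s' \<circ> t' = s \<circ> t \<and> max_moved s' < max_moved t' \<and> max_moved s' < max_moved s"
proof -
  obtain a x where a: "s = signed_swap a x" "0 < a" "a \<le> int n" "x \<noteq> 0" "\<bar>x\<bar> \<le> a" "x \<noteq> a"
    "int (max_moved s) = a" using s by (rule reflectionE)
  obtain b y where b: "t = signed_swap b y" "0 < b" "b \<le> int n" "y \<noteq> 0" "\<bar>y\<bar> \<le> b" "y \<noteq> b"
    "int (max_moved t) = b" using t by (rule reflectionE)
  \<comment> \<open>It suffices to find a left factor on points \<open>p\<close>, \<open>q\<close>
    below \<open>a\<close> and a right factor that moves \<open>a\<close> to
    \<open>z\<close>.\<close>
  have *: ?thesis
    if "signed_swap p q \<circ> signed_swap a z = s \<circ> t" "p \<noteq> 0" "q \<noteq> 0" "p \<noteq> q" "\<bar>p\<bar> < a" "\<bar>q\<bar> < a"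
      "z \<noteq> 0" "\<bar>z\<bar> \<le> a" "z \<noteq> a" for p q z
  proof (intro bexI conjI)
    show "signed_swap p q \<circ> signed_swap a z = s \<circ> t" by fact
    have "int (max_moved (signed_swap p q)) < a" "int (max_moved (signed_swap a z)) = a"
      using that a(2) by (simp_all add: max_moved_signed_swap)
    then show "max_moved (signed_swap p q) < max_moved (signed_swap a z)"
      "max_moved (signed_swap p q) < max_moved s" using a(7) by linarith+
    show "signed_swap p q \<in> reflections n" "signed_swap a z \<in> reflections n"
      using that a(2,3) by (auto intro: signed_swap_reflection)
  qed
  have "s \<noteq> t" using ne reflection_involution[OF s] by auto
  consider "b < a" | "b = a" "x = - a" | "b = a" "\<bar>x\<bar> < a" "y = - x"
    | "b = a" "\<bar>x\<bar> < a" "y \<noteq> - x"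
    using a(5-7) b(7) le by linarith
  then show ?thesis
  proof cases
    case 1
    \<comment> \<open>Here \<open>t\<close> fixes \<open>a\<close>, so moving \<open>t\<close> to
      the left conjugates \<open>s\<close> into \<open>signed_swap a (t x)\<close>.\<close>
    have invol: "t (t p) = p" for p
      using reflection_involution[OF t] by (metis comp_apply id_apply)
    have "t \<circ> signed_swap a (t x) = signed_swap (t a) (t (t x)) \<circ> t"
      using b(1,2,4) by (intro signed_swap_conjugate inj_reflection[OF t]) (simp add: signed_swap_neg)
    moreover have "t a = a" using reflection_fixes[OF t, of a] 1 b(7) by simp
    ultimately have "t \<circ> signed_swap a (t x) = s \<circ> t" by (simp add: invol a(1))
    moreover have "t x \<noteq> 0" "\<bar>t x\<bar> \<le> a" "t x \<noteq> a"
      using 1 a(2,4-6) b(2,4,5) unfolding b(1) signed_swap_def by auto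
    ultimately show ?thesis using 1 b by (intro *[of b y "t x"]) auto
  next
    case 2
    \<comment> \<open>Here \<open>s = [a]\<close>. Conjugating \<open>t\<close> by \<open>s\<close>
      gives \<open>s \<circ> t = ?r \<circ> s\<close>, and conjugating \<open>s\<close> by
      \<open>?r\<close> turns this into \<open>[y] \<circ> ?r\<close>, up to the sign of
      \<open>y\<close>.\<close>
    have "y \<noteq> - a" using \<open>s \<noteq> t\<close> 2 a(1) b(1) by auto
    then have y: "\<bar>y\<bar> < a" using b(5,6) 2 by linarith
    let ?r = "signed_swap a (- y)"
    have r: "?r \<in> reflections n" using a(2,3) b(4) y by (intro signed_swap_reflection) auto
    have "?r \<circ> signed_swap (- a) a = signed_swap (?r (- a)) (?r a) \<circ> ?r"
      using a(2) b(4) by (intro signed_swap_conjugate inj_reflection[OF r]) (simp add: signed_swap_neg)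
    moreover have "?r a = - y" "?r (- a) = y" using a(2) b(4) y by (auto simp: signed_swap_def)
    moreover have "s \<circ> signed_swap a y = signed_swap (s a) (s y) \<circ> s"
      using a(1,2,4) by (intro signed_swap_conjugate inj_reflection[OF s]) (simp add: signed_swap_neg)
    moreover have "s a = - a" "s y = y" using 2 a(1,2) y by (auto simp: signed_swap_def)
    moreover have "signed_swap (- a) y = ?r" "signed_swap (- a) a = s"
      using signed_swap_uminus[of a "- y"] signed_swap_commute[of a] 2 a(1,2) b(4) by auto
    ultimately have "signed_swap y (- y) \<circ> ?r = s \<circ> t" using 2 b(1) by simp
    then show ?thesis using y b(4) by (intro *[of y "- y" "- y"]) auto
  next
    case 3
    \<comment> \<open>The two reflections on the same pair of absolute values multiply to the sign
      changes at \<open>x\<close> and \<open>a\<close>.\<close>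
    have "signed_swap x (- x) \<circ> signed_swap a (- a) = signed_swap a x \<circ> signed_swap a (- x)"
    proof -
      have "a \<noteq> 0" "x \<noteq> 0" "x \<noteq> a" "x \<noteq> - a" using 3 a(2,4) by auto
      then show ?thesis by (intro ext) (auto simp: signed_swap_def)
    qed
    then show ?thesis using 3 a b(1) by (intro *[of x "- x" "- a"]) auto
  next
    case 4
    \<comment> \<open>Conjugating \<open>t\<close> by \<open>s\<close> leaves \<open>s\<close> on
      the right and \<open>signed_swap x (s y)\<close> on the left. The excluded values
      \<open>x\<close> and \<open>- x\<close> of \<open>y\<close> are those that \<open>s\<close>
      sends to absolute value \<open>a\<close>.\<close>
    have "y \<noteq> x" using \<open>s \<noteq> t\<close> 4 a(1) b(1) by auto
    have "s \<circ> signed_swap a y = signed_swap (s a) (s y) \<circ> s"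
      using a(1,2,4) by (intro signed_swap_conjugate inj_reflection[OF s]) (simp add: signed_swap_neg)
    moreover have "s a = x" using a(1) by (simp add: signed_swap_def)
    ultimately have "signed_swap x (s y) \<circ> signed_swap a x = s \<circ> t" using 4 a(1) b(1) by simp
    moreover have "s y = (if y = - a then - x else y)"
      using \<open>y \<noteq> x\<close> 4 a(1,2) b(6) by (auto simp: signed_swap_def)
    ultimately show ?thesis
      using \<open>y \<noteq> x\<close> 4 a(2,4) b(4-6) by (intro *[of x "s y" x]) (auto split: if_splits)
  qed
qed

section \<open>Uniqueness of rising words of reflections\<close>

lemma word_fixes:
  assumes "set ts \<subseteq> reflections n" "\<And>t. t \<in> set ts \<Longrightarrow> int (max_moved t) < \<bar>p\<bar>"
  shows "word_prod ts p = p"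
  using assms by (induction ts) (auto simp: reflection_fixes)

text \<open>The earlier letters have smaller labels and fix \<open>m\<close>. Hence \<open>m\<close>
  is the largest point that the product moves, and \<open>t m\<close> is its preimage.\<close>

lemma rising_last:
  assumes ts: "set (ts @ [t]) \<subseteq> reflections n"
    and rising: "sorted_wrt (<) (map max_moved (ts @ [t]))"
  defines "m \<equiv> int (max_moved t)"
  shows "word_prod (ts @ [t]) (t m) = m" "word_prod (ts @ [t]) m \<noteq> m"
    "m < \<bar>p\<bar> \<Longrightarrow> word_prod (ts @ [t]) p = p"
proof -
  have T: "t \<in> reflections n" "set ts \<subseteq> reflections n" using ts by auto
  have less: "int (max_moved s) < m" if "s \<in> set ts" for s
    using rising that unfolding m_def by (auto simp: sorted_wrt_append)
  have inv: "t (t q) = q" for q using reflection_involution[OF T(1)] by (metis comp_apply id_apply)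
  have m: "m = \<bar>m\<bar>" by (simp add: m_def)
  have "word_prod ts m = m" using word_fixes[OF T(2), of m] less m by metis
  then show "word_prod (ts @ [t]) (t m) = m" by (simp add: word_prod_append inv)
  have "inj (word_prod ts)" using T(2) by (rule inj_word)
  moreover have "t m \<noteq> m" using reflection_moves[OF T(1)] by (simp add: m_def)
  moreover have "word_prod (ts @ [t]) m = word_prod ts (t m)" by (simp add: word_prod_append)
  ultimately show "word_prod (ts @ [t]) m \<noteq> m"
    using \<open>word_prod ts m = m\<close> by (metis injD)
  show "word_prod (ts @ [t]) p = p" if "m < \<bar>p\<bar>"
  proof (rule word_fixes[OF ts])
    fix s assume "s \<in> set (ts @ [t])"
    then have "int (max_moved s) \<le> m" using less unfolding m_def by fastforce
    then show "int (max_moved s) < \<bar>p\<bar>" using that by simp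
  qed
qed

text \<open>By \<open>rising_last\<close> the product determines the label of the last letter and
  its value there, hence the last letter itself; cancel it and repeat.\<close>

lemma reflections_rising_unique:
  assumes "set xs \<subseteq> reflections n" "set ys \<subseteq> reflections n"
    and "sorted_wrt (<) (map max_moved xs)" "sorted_wrt (<) (map max_moved ys)"
    and "word_prod xs = word_prod ys"
  shows "xs = ys"
  using assms
proof (induction xs arbitrary: ys rule: rev_induct)
  case Nil
  show ?case
  proof (cases ys rule: rev_cases)
    case (snoc ys' s)
    then show ?thesis using rising_last(2)[of ys' s n] Nil by (metis foldr.simps(1) id_apply)
  qed simp
next
  case (snoc t xs)
  show ?case
  proof (cases ys rule: rev_cases)
    case Nil
    then show ?thesis
      using rising_last(2)[OF snoc.prems(1,3)] snoc.prems(5) by (metis foldr.simps(1) id_apply)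
  next
    case ys: (snoc ys' s)
    let ?w = "word_prod (xs @ [t])"
    note X = rising_last[OF snoc.prems(1,3)]
    note Y = rising_last[OF snoc.prems(2,4)[unfolded ys], folded ys, folded snoc.prems(5)]
    have "\<not> max_moved t < max_moved s" "\<not> max_moved s < max_moved t"
      using X(2) Y(2) X(3)[of "int (max_moved s)"] Y(3)[of "int (max_moved t)"] by auto
    then have m: "max_moved s = max_moved t" by simp
    have T: "t \<in> reflections n" "s \<in> reflections n" using snoc.prems ys by auto
    have "inj ?w" using snoc.prems(1) by (rule inj_word)
    then have "t (int (max_moved t)) = s (int (max_moved t))"
      using X(1) Y(1) m by (metis injD)
    then have st: "s = t" using reflection_eq_signed_swap[OF T(1)] reflection_eq_signed_swap[OF T(2)] m by metis
    have "word_prod xs \<circ> t = word_prod ys' \<circ> t"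
      using snoc.prems(5) unfolding ys st word_prod_append word_prod_simps comp_id .
    then have "word_prod xs \<circ> (t \<circ> t) = word_prod ys' \<circ> (t \<circ> t)"
      by (simp only: comp_assoc[symmetric])
    then have "word_prod xs = word_prod ys'"
      by (simp only: reflection_involution[OF T(1)] comp_id)
    moreover have "set xs \<subseteq> reflections n" "set ys' \<subseteq> reflections n"
      "sorted_wrt (<) (map max_moved xs)" "sorted_wrt (<) (map max_moved ys')"
      using snoc.prems(1-4) ys by (auto simp: sorted_wrt_append)
    ultimately have "xs = ys'" by (intro snoc.IH)
    then show ?thesis using ys st by simp
  qed
qed

interpretation reflections: labelled_involutions "reflections n" max_moved for n
  using finite_reflections reflection_involution reflections_straighten reflections_rising_unique
  by unfold_locales

section \<open>Reflections generate the hyperoctahedral group\<close>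

lemma hyperoctahedral_neg: "w \<in> hyperoctahedral n \<Longrightarrow> w (- p) = - w p"
proof (cases "p \<in> signed_points n")
  case False
  then have "- p \<notin> signed_points n" by (simp add: signed_points_def)
  moreover assume "w \<in> hyperoctahedral n"
  ultimately show ?thesis using False by (metis (lifting) hyperoctahedral_def mem_Collect_eq permutes_not_in)
qed (simp add: hyperoctahedral_def)

lemma hyperoctahedral_comp:
  assumes "u \<in> hyperoctahedral n" "v \<in> hyperoctahedral n"
  shows "u \<circ> v \<in> hyperoctahedral n"
proof -
  have "u \<circ> v permutes signed_points n"
    using assms unfolding hyperoctahedral_def by (intro permutes_compose) simp_all
  then show ?thesis
    using hyperoctahedral_neg[OF assms(1)] hyperoctahedral_neg[OF assms(2)]
    by (simp add: hyperoctahedral_def)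
qed

lemma reflection_hyperoctahedral:
  assumes "t \<in> reflections n"
  shows "t \<in> hyperoctahedral n"
proof -
  obtain a x where a: "t = signed_swap a x" "0 < a" "a \<le> int n" "x \<noteq> 0" "\<bar>x\<bar> \<le> a" "x \<noteq> a"
    using assms by (rule reflectionE)
  have "bij t" using o_bij reflection_involution[OF assms] by blast
  moreover have "t p = p" if "p \<notin> signed_points n" for p
    using that a by (auto simp: signed_points_def signed_swap_def)
  ultimately have "t permutes signed_points n" by (simp add: permutes_def bij_iff)
  then show ?thesis using a by (simp add: hyperoctahedral_def signed_swap_neg)
qed

text \<open>Induction on a bound for the moved points: multiplying on the right by the reflection
  that swaps the largest point with its preimage makes that point fixed.\<close>

lemma hyperoctahedral_word:
  assumes "w \<in> hyperoctahedral n" "m \<le> n" "\<And>p. int m < \<bar>p\<bar> \<Longrightarrow> w p = p"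
  shows "\<exists>ts. set ts \<subseteq> reflections n \<and> w = word_prod ts"
  using assms
proof (induction m arbitrary: w)
  case 0
  \<comment> \<open>The bound 0 leaves only the point 0, which oddness fixes.\<close>
  have "w 0 = 0" using hyperoctahedral_neg[OF 0(1), of 0] by simp
  then have "w = id" using 0(3) by (intro ext) (metis id_apply of_nat_0 zero_less_abs_iff)
  then show ?case by (intro exI[of _ "[]"]) simp
next
  case (Suc m)
  let ?a = "int (Suc m)"
  have neg: "w (- p) = - w p" for p using hyperoctahedral_neg[OF Suc.prems(1)] .
  show ?case
  proof (cases "w ?a = ?a")
    case True
    then have "w p = p" if "int m < \<bar>p\<bar>" for p
    proof -
      have "?a < \<bar>p\<bar> \<or> p = ?a \<or> p = - ?a" using that by arith
      then consider "?a < \<bar>p\<bar>" | "p = ?a" | "p = - ?a" by blast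
      then show ?thesis using Suc.prems(3) True neg[of ?a] by cases auto
    qed
    then show ?thesis using Suc.IH Suc.prems by simp
  next
    case False
    have perm: "w permutes signed_points n" using Suc.prems(1) by (simp add: hyperoctahedral_def)
    obtain x where x: "w x = ?a" using permutes_surj[OF perm] by (metis surjD)
    have xa: "x \<noteq> ?a" "x \<noteq> 0" "\<bar>x\<bar> \<le> ?a"
    proof -
      show "x \<noteq> ?a" using x False by auto
      show "x \<noteq> 0" using x neg[of 0] by auto
      show "\<bar>x\<bar> \<le> ?a" using Suc.prems(3)[of x] x by (cases "?a < \<bar>x\<bar>") auto
    qed
    let ?t = "signed_swap ?a x"
    have t: "?t \<in> reflections n" using xa Suc.prems(2) by (intro signed_swap_reflection) auto
    have fixed: "(w \<circ> ?t) p = p" if "int m < \<bar>p\<bar>" for p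
    proof -
      have "?a < \<bar>p\<bar> \<or> p = ?a \<or> p = - ?a" using that by arith
      then consider "?a < \<bar>p\<bar>" | "p = ?a" | "p = - ?a" by blast
      then show ?thesis
      proof cases
        case 1
        then show ?thesis using Suc.prems(3) xa by (auto simp: signed_swap_def)
      next
        case 2
        then show ?thesis using x by (simp add: signed_swap_def)
      next
        case 3
        then have "?t p = - x" using xa by (auto simp: signed_swap_def)
        then show ?thesis using 3 x neg[of x] by simp
      qed
    qed
    have "\<exists>ts. set ts \<subseteq> reflections n \<and> w \<circ> ?t = word_prod ts"
    proof (rule Suc.IH)
      show "w \<circ> ?t \<in> hyperoctahedral n"
        by (rule hyperoctahedral_comp[OF Suc.prems(1) reflection_hyperoctahedral[OF t]])
    qed (use Suc.prems(2) fixed in auto)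
    then obtain ts where ts: "set ts \<subseteq> reflections n" "w \<circ> ?t = word_prod ts" by blast
    have "word_prod (ts @ [?t]) = w \<circ> (?t \<circ> ?t)" by (simp add: word_prod_append ts(2)[symmetric] comp_assoc)
    also have "\<dots> = w" using reflection_involution[OF t] by simp
    finally have "w = word_prod (ts @ [?t])" ..
    moreover have "set (ts @ [?t]) \<subseteq> reflections n" using ts(1) t by simp
    ultimately show ?thesis by blast
  qed
qed

lemma hyperoctahedral_eq_generated: "hyperoctahedral n = reflections.generated n"
proof
  show "hyperoctahedral n \<subseteq> reflections.generated n"
  proof
    fix w assume w: "w \<in> hyperoctahedral n"
    then have "w p = p" if "int n < \<bar>p\<bar>" for p
      using that by (auto simp: hyperoctahedral_def signed_points_def permutes_not_in)
    then show "w \<in> reflections.generated n"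
      using hyperoctahedral_word[OF w order_refl] unfolding reflections.generated_def by blast
  qed
  have "word_prod ts \<in> hyperoctahedral n" if "set ts \<subseteq> reflections n" for ts
    using that
  proof (induction ts)
    case Nil
    have "id \<in> hyperoctahedral n"
      unfolding hyperoctahedral_def by (intro CollectI conjI permutes_id) simp
    then show ?case unfolding word_prod_simps .
  next
    case (Cons t ts)
    then have "t \<in> hyperoctahedral n" by (intro reflection_hyperoctahedral) simp
    moreover have "word_prod ts \<in> hyperoctahedral n" using Cons.prems by (intro Cons.IH) simp
    ultimately show ?case unfolding word_prod_simps by (intro hyperoctahedral_comp)
  qed
  then show "reflections.generated n \<subseteq> hyperoctahedral n"
    unfolding reflections.generated_def by blast
qed

lemma absolute_le_eq: "absolute_le n = reflections.le n"
  by (intro ext) (simp add: absolute_le_def reflections.le_def absolute_length_def reflections.len_def)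

theorem theorem1p5:
  fixes n :: nat and u v :: "int \<Rightarrow> int"
  assumes "n \<ge> 1"
    and "u \<in> hyperoctahedral n" and "v \<in> hyperoctahedral n"
    and "absolute_le n u v"
  shows "shellable_poset (absolute_interval n u v) (absolute_le n)"
  \<comment> \<open>For the reflections, the group, order and interval of the locale are those of
    the statement.\<close>
  using reflections.shellable_interval[of u n v] assms(2-4)
  by (simp add: absolute_le_eq hyperoctahedral_eq_generated absolute_interval_def
    reflections.interval_def)

end
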